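(* Let $k=o(\log d)$, and let $p$ be a real $d$-variate polynomial satisfying $|p(x)-\mathrm{OR}_d(x)|\le 1/6$ for all $x\in\{-1,1\}^d$ with $|x|\le k$. If the $L_1$-weight of the coefficient vector of $p$ is $d^{O(1)}$, then the degree of $p$ is at least $d^{1-O(1/\sqrt{k})}$.
   Context: $\mathrm{OR}_d:\{-1,1\}^d\to\{-1,1\}$ is the OR function on $d$ variables with the convention that $-1$ means TRUE and $1$ means FALSE. For $x\in\{-1,1\}^d$, $|x|$ denotes the number of coordinates of $x$ equal to $-1$. A real polynomial is written in multilinear form $p(x)=\sum_{S\subseteq[d]}c_S\prod_{i\in S}x_i$; its $L_1$-weight is $\sum_S|c_S|$ and its degree is $\max\{|S|:c_S\ne0\}$. Asymptotic notation is with respect to $d\to\infty$. *)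

theory Defs
  imports Complex_Main "HOL-Library.FuncSet" "HOL-Library.Landau_Symbols"
begin

text \<open>
  Truth values are the reals \<open>-1\<close> (true) and \<open>1\<close> (false). A multilinear real polynomial in
  \<open>d\<close> variables is given by its coefficient function \<open>c :: nat set \<Rightarrow> real\<close>, of which only the
  values on subsets of \<open>{1..d}\<close> matter.
\<close>

definition cube :: "nat \<Rightarrow> (nat \<Rightarrow> real) set" where
  "cube d = {1..d} \<rightarrow>\<^sub>E {-1, 1}"

definition OR_fun :: "nat \<Rightarrow> (nat \<Rightarrow> real) \<Rightarrow> real" where
  "OR_fun d x = (if \<exists>i\<in>{1..d}. x i = -1 then -1 else 1)"

definition hamming_weight :: "nat \<Rightarrow> (nat \<Rightarrow> real) \<Rightarrow> nat" where
  "hamming_weight d x = card {i \<in> {1..d}. x i = -1}"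

definition mpoly_eval :: "nat \<Rightarrow> (nat set \<Rightarrow> real) \<Rightarrow> (nat \<Rightarrow> real) \<Rightarrow> real" where
  "mpoly_eval d c x = (\<Sum>S\<in>Pow {1..d}. c S * (\<Prod>i\<in>S. x i))"

definition L1_weight :: "nat \<Rightarrow> (nat set \<Rightarrow> real) \<Rightarrow> real" where
  "L1_weight d c = (\<Sum>S\<in>Pow {1..d}. \<bar>c S\<bar>)"

text \<open>Unspecified for the zero polynomial, where the maximum is over the empty set.\<close>
definition mpoly_degree :: "nat \<Rightarrow> (nat set \<Rightarrow> real) \<Rightarrow> nat" where
  "mpoly_degree d c = Max {card S | S. S \<subseteq> {1..d} \<and> c S \<noteq> 0}"

end

theory Submission
  imports Defs "HOL-Computational_Algebra.Polynomial"
begin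

text \<open>
  Average \<open>p\<close> over the points of Hamming weight \<open>t\<close>. Since the average of \<open>\<Prod>i\<in>S. x i\<close> is
  \<open>\<Sum>i\<le>t. (-2) ^ i * (card S choose i) / (d choose i) * (t choose i)\<close>, the \<open>i\<close>-th Newton coefficient of
  the averaged polynomial is at most \<open>W * (2 * D / d) ^ i\<close>, where \<open>W\<close> is the weight and \<open>D\<close> the degree
  of \<open>p\<close>. If \<open>D < d powr (1 - A / sqrt k)\<close>, then dropping the terms beyond \<open>i = sqrt k / 2\<close> changes the
  values at \<open>t \<le> k\<close> by at most \<open>1 / 6\<close>, because \<open>W\<close> is polynomial in \<open>d\<close> and \<open>2 ^ k\<close> is subpolynomial.
  What remains is a univariate polynomial of degree at most \<open>sqrt k / 2\<close> that is close to \<open>1\<close> at \<open>0\<close>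
  and close to \<open>-1\<close> at \<open>1, \<dots>, k\<close>. Lagrange interpolation at the nodes \<open>1\<close> and \<open>4 * i\<^sup>2\<close> shows that
  there is none: the basis polynomials at \<open>0\<close> have total absolute value at most \<open>3\<close>.
\<close>

section \<open>Lagrange interpolation at \<open>1\<close> and \<open>4 * i^2\<close>\<close>

lemma lagrange_interpolation:
  fixes p :: "'a::field poly"
  assumes fin: "finite T" and deg: "degree p < card T"
  shows "poly p x = (\<Sum>t\<in>T. poly p t * (\<Prod>s\<in>T - {t}. (x - s) / (t - s)))"
proof -
  define b where "b t = (\<Prod>s\<in>T - {t}. smult (inverse (t - s)) [:- s, 1:])" for t
  define q where "q = (\<Sum>t\<in>T. smult (poly p t) (b t))"
  have poly_b: "poly (b t) y = (\<Prod>s\<in>T - {t}. (y - s) / (t - s))" for t y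
    by (simp add: b_def poly_prod divide_inverse algebra_simps)
  have b_eq: "poly (b t) y = (if t = y then 1 else 0)" if "t \<in> T" "y \<in> T" for t y
  proof (cases "t = y")
    case True
    then show ?thesis unfolding poly_b by (auto intro!: prod.neutral simp del: divide_self_if)
  next
    case False
    then show ?thesis using that fin by (auto simp: poly_b intro!: bexI[of _ y])
  qed
  have "degree (b t) \<le> card T - 1" if "t \<in> T" for t
  proof -
    have "degree (b t) \<le> (\<Sum>s\<in>T - {t}. degree (smult (inverse (t - s)) [:- s, 1:]))"
      unfolding b_def using degree_prod_sum_le[of "T - {t}" "\<lambda>s. smult (inverse (t - s)) [:- s, 1:]"] fin
      unfolding o_def by blast
    also have "\<dots> \<le> (\<Sum>s\<in>T - {t}. 1)"
      by (intro sum_mono order.trans[OF degree_smult_le]) auto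
    finally show ?thesis using that fin by simp
  qed
  then have "degree q \<le> card T - 1"
    unfolding q_def using fin by (intro degree_sum_le) (auto intro: order.trans[OF degree_smult_le])
  then have degq: "degree q < card T" using deg by linarith
  have "poly p y = poly q y" if "y \<in> T" for y
    using that fin by (simp add: q_def poly_sum b_eq if_distrib sum.delta' cong: if_cong sum.cong)
  then have "p = q"
    using deg degq by (intro poly_eqI_degree[of T]) auto
  then have "poly p x = poly q x" by simp
  then show ?thesis by (simp add: q_def poly_sum poly_b)
qed

text \<open>The Weierstrass product inequality. It keeps the denominator of the basis polynomial of
  the node \<open>1\<close> at least \<open>1 / 2\<close>.\<close>

lemma prod_one_minus_ge:
  fixes f :: "'a \<Rightarrow> real"
  assumes "finite I" "\<And>i. i \<in> I \<Longrightarrow> 0 \<le> f i" "\<And>i. i \<in> I \<Longrightarrow> f i \<le> 1"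
  shows "1 - sum f I \<le> (\<Prod>i\<in>I. 1 - f i)"
  using assms
proof (induction I rule: finite_induct)
  case (insert i I)
  have "(1 - f i) * (1 - sum f I) \<le> (1 - f i) * (\<Prod>i\<in>I. 1 - f i)"
    using insert by (intro mult_left_mono) auto
  moreover have "0 \<le> f i * sum f I" using insert by (intro mult_nonneg_nonneg sum_nonneg) auto
  ultimately show ?case using insert by (simp add: algebra_simps)
qed simp

text \<open>Telescopes, since \<open>4 * i^2 - 1\<close> is the product of \<open>2 * i - 1\<close>
  and \<open>2 * i + 1\<close>. What is used later is that the sum stays below \<open>1 / 2\<close>
  for every \<open>n\<close>.\<close>

lemma sum_inverse_four_squares:
  "(\<Sum>i=1..n. 1 / (4 * (real i)\<^sup>2 - 1)) = (1 - 1 / (2 * real n + 1)) / 2"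
proof (induction n)
  case (Suc n)
  have "4 * (real (Suc n))\<^sup>2 - 1 = (2 * real n + 1) * (2 * real n + 3)"
    by (simp add: power2_eq_square algebra_simps)
  then have "1 / (4 * (real (Suc n))\<^sup>2 - 1) = (1 / (2 * real n + 1) - 1 / (2 * real (Suc n) + 1)) / 2"
    by (simp add: divide_simps)
  then show ?case using Suc by (simp add: diff_divide_distrib del: of_nat_Suc)
qed simp

lemma abs_diff_squares:
  "b \<le> a \<Longrightarrow> \<bar>(real a)\<^sup>2 - (real b)\<^sup>2\<bar> = (real a - real b) * (real a + real b)"
  by (simp add: power2_eq_square square_diff_square_factored abs_mult)

text \<open>Up to sign, this is the value at \<open>0\<close> of the Lagrange basis polynomial of
  \<open>i^2\<close> for the nodes \<open>1, 4, ..., n^2\<close>. Factoring \<open>i^2 - j^2\<close>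
  gives factorials. The induction starts at \<open>n = i\<close>, so the base case contains exactly
  the factors with \<open>j < i\<close>, and every later factor has \<open>j > i\<close>, which
  settles the signs.\<close>

lemma prod_squares_ratio:
  assumes "1 \<le> i" "i \<le> n"
  shows "(\<Prod>j\<in>{1..n} - {i}. (real j)\<^sup>2 / \<bar>(real i)\<^sup>2 - (real j)\<^sup>2\<bar>) =
         2 * (fact n)\<^sup>2 / (fact (n - i) * fact (n + i))"
  using assms(2)
proof (induction n rule: dec_induct)
  case base
  \<comment> \<open>Both partial products are stated with the missing factorial multiplied in, so
    that the inductions involve no quotients.\<close>
  have up: "(\<Prod>j=1..m. real i + real j) * fact i = fact (i + m)" for m
  proof (induction m)
    case (Suc m)
    have "(\<Prod>j=1..Suc m. real i + real j) * fact i = (real i + real (Suc m)) * fact (i + m)"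
      using Suc by (simp del: of_nat_Suc)
    then show ?case by (simp add: algebra_simps)
  qed simp
  have down: "m < i \<Longrightarrow> (\<Prod>j=1..m. real i - real j) * fact (i - 1 - m) = fact (i - 1)" for m
  proof (induction m)
    case (Suc m)
    have "i - 1 - m = Suc (i - 1 - Suc m)" using Suc.prems by simp
    then have "fact (i - 1 - m) = (real i - real (Suc m)) * fact (i - 1 - Suc m)"
      using Suc.prems by (simp add: of_nat_diff algebra_simps)
    moreover have "(\<Prod>j=1..m. real i - real j) * fact (i - 1 - m) = fact (i - 1)"
      using Suc by simp
    ultimately show ?case by (simp del: of_nat_Suc)
  qed simp
  obtain l where l: "i = Suc l" using assms(1) by (cases i) auto
  have set: "{1..i} - {i} = {1..l}" using l by auto
  have sq: "(\<Prod>j=1..l. (real j)\<^sup>2) = (fact l)\<^sup>2"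
    by (simp add: fact_prod prod_power_distrib)
  have "(\<Prod>j=1..l. \<bar>(real i)\<^sup>2 - (real j)\<^sup>2\<bar>) = (\<Prod>j=1..l. (real i - real j) * (real i + real j))"
    using l by (intro prod.cong refl abs_diff_squares) auto
  also have "\<dots> = fact l * (fact (i + l) / fact i)"
  proof -
    have "(\<Prod>j=1..l. real i + real j) = fact (i + l) / fact i"
      unfolding up[symmetric] by simp
    moreover have "(\<Prod>j=1..l. real i - real j) = fact l"
      using down[of l] l by simp
    ultimately show ?thesis by (simp only: prod.distrib)
  qed
  finally have den: "(\<Prod>j=1..l. \<bar>(real i)\<^sup>2 - (real j)\<^sup>2\<bar>) = fact l * (fact (i + l) / fact i)" .
  have facts: "fact (i + i) = 2 * real i * fact (i + l)" "fact i = real i * fact l" "real i \<noteq> 0"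
    using l by auto
  show ?case unfolding set prod_dividef sq den
    using facts by (simp add: power2_eq_square divide_simps)
next
  case (step n)
  have set: "{1..Suc n} - {i} = insert (Suc n) ({1..n} - {i})" using step by auto
  have abs: "\<bar>(real i)\<^sup>2 - (real (Suc n))\<^sup>2\<bar> = (real (Suc n) - real i) * (real (Suc n) + real i)"
    using step abs_diff_squares[of i "Suc n"] by (simp only: abs_minus_commute)
  have f: "fact (Suc n - i) = (real (Suc n) - real i) * fact (n - i)"
    using step by (simp add: Suc_diff_le of_nat_diff)
  have g: "fact (Suc n + i) = (real (Suc n) + real i) * fact (n + i)"
    by (simp add: algebra_simps)
  have h: "fact (Suc n) = real (Suc n) * fact n" by simp
  have nz: "real (Suc n) - real i \<noteq> 0" "real (Suc n) + real i \<noteq> 0" using step by auto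
  show ?case unfolding set f g h
    using step.IH abs nz by (simp add: power_mult_distrib mult_ac del: of_nat_Suc fact_Suc)
qed

text \<open>The closed form is twice the quotient of \<open>2 * n choose (n - i)\<close> by the
  central binomial coefficient, which is the largest in its row.\<close>

lemma prod_squares_ratio_le:
  assumes "1 \<le> i" "i \<le> n"
  shows "(\<Prod>j\<in>{1..n} - {i}. (real j)\<^sup>2 / \<bar>(real i)\<^sup>2 - (real j)\<^sup>2\<bar>) \<le> 2"
proof -
  have "real (2 * n choose (n - i)) \<le> real (2 * n choose n)"
    by (metis binomial_maximum nonzero_mult_div_cancel_left numeral_neq_zero of_nat_mono zero_neq_numeral)
  moreover have "real (2 * n choose (n - i)) = fact (2 * n) / (fact (n - i) * fact (n + i))"
    using assms by (subst binomial_fact) (auto simp: mult_2)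
  moreover have "real (2 * n choose n) = fact (2 * n) / (fact n)\<^sup>2"
    by (subst binomial_fact) (auto simp: mult_2 power2_eq_square)
  ultimately have "fact (2 * n) / (fact (n - i) * fact (n + i)) \<le> (fact (2 * n) / (fact n)\<^sup>2 :: real)"
    by simp
  then have "(fact n)\<^sup>2 / (fact (n - i) * fact (n + i)) \<le> (1::real)"
    by (simp add: divide_simps split: if_splits)
  then show ?thesis unfolding prod_squares_ratio[OF assms] times_divide_eq_right[symmetric] by linarith
qed

text \<open>At \<open>0\<close>, the basis polynomial of \<open>1\<close> is at most
  \<open>2\<close> in absolute value, and that of \<open>4 * i^2\<close> is at most
  \<open>2 / (4 * i^2 - 1)\<close>. The extra node \<open>1\<close> supplies the denominator
  \<open>4 * i^2 - 1\<close>, and this makes the total bounded independently of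
  \<open>n\<close>.\<close>

lemma poly_zero_le_of_square_nodes:
  fixes q :: "real poly"
  assumes deg: "degree q \<le> n"
    and one: "\<bar>poly q 1\<bar> \<le> e"
    and sq: "\<And>i. i \<in> {1..n} \<Longrightarrow> \<bar>poly q (4 * (real i)\<^sup>2)\<bar> \<le> e"
  shows "\<bar>poly q 0\<bar> \<le> 3 * e"
proof -
  define f where "f i = 4 * (real i)\<^sup>2" for i
  define L where "L T t = (\<Prod>s\<in>T - {t}. (0 - s) / (t - s))" for T and t :: real
  define T where "T = insert 1 (f ` {1..n})"
  have inj: "inj_on f A" for A
    by (auto simp: inj_on_def f_def)
  have f_ge: "f i \<ge> 4" if "1 \<le> i" for i
    using that by (simp add: f_def)
  have one_notin: "1 \<notin> f ` {1..n}"
    using f_ge by force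
  have e: "e \<ge> 0" using one by linarith
  have "card T = Suc n" using one_notin by (simp add: T_def card_image inj)
  then have "poly q 0 = (\<Sum>t\<in>T. poly q t * L T t)"
    unfolding L_def using deg by (intro lagrange_interpolation) (auto simp: T_def)
  also have "\<dots> = poly q 1 * L T 1 + (\<Sum>i=1..n. poly q (f i) * L T (f i))"
    using one_notin by (simp add: T_def sum.reindex inj)
  finally have "\<bar>poly q 0\<bar> \<le> \<bar>poly q 1 * L T 1\<bar> + (\<Sum>i=1..n. \<bar>poly q (f i) * L T (f i)\<bar>)"
    using sum_abs[of "\<lambda>i. poly q (f i) * L T (f i)" "{1..n}"] by linarith
  also have "\<dots> \<le> e * \<bar>L T 1\<bar> + (\<Sum>i=1..n. e * \<bar>L T (f i)\<bar>)"
    unfolding abs_mult using one sq by (intro add_mono sum_mono mult_right_mono) (auto simp: f_def)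
  also have "\<dots> = e * (\<bar>L T 1\<bar> + (\<Sum>i=1..n. \<bar>L T (f i)\<bar>))"
    by (simp add: sum_distrib_left distrib_left)
  also have "\<dots> \<le> e * (2 + 1)"
  proof (intro mult_left_mono add_mono e)
    have "T - {1} = f ` {1..n}" using one_notin by (auto simp: T_def)
    then have "L T 1 = (\<Prod>i=1..n. (0 - f i) / (1 - f i))"
      by (simp add: L_def prod.reindex inj)
    also have "\<dots> = (\<Prod>i=1..n. inverse (1 - 1 / f i))"
      using f_ge by (intro prod.cong) (force simp: divide_simps)+
    also have "\<dots> = inverse (\<Prod>i=1..n. 1 - 1 / f i)"
      using prod_inversef[of "\<lambda>i. 1 - 1 / f i" "{1..n}"] by (simp add: o_def)
    finally have L1: "L T 1 = inverse (\<Prod>i=1..n. 1 - 1 / f i)" .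
    have f4: "1 / f i \<le> 1" "0 \<le> 1 / f i" "1 / f i \<le> 1 / (f i - 1)" if "i \<in> {1..n}" for i
      using f_ge[of i] that by (auto simp: divide_simps)
    \<comment> \<open>Enlarging \<open>1 / (4 * i^2)\<close> to \<open>1 / (4 * i^2 - 1)\<close>
      makes the sum telescope.\<close>
    have "(\<Sum>i=1..n. 1 / f i) \<le> (\<Sum>i=1..n. 1 / (f i - 1))"
      using f4 by (intro sum_mono) auto
    also have "\<dots> = (1 - 1 / (2 * real n + 1)) / 2"
      using sum_inverse_four_squares[of n] by (simp add: f_def)
    also have "\<dots> \<le> 1 / 2" by simp
    finally have "1 / 2 \<le> (\<Prod>i=1..n. 1 - 1 / f i)"
      using prod_one_minus_ge[of "{1..n}" "\<lambda>i. 1 / f i"] f4 by force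
    then have "inverse (\<Prod>i=1..n. 1 - 1 / f i) \<le> inverse (1 / 2)"
      by (intro le_imp_inverse_le) auto
    then show "\<bar>L T 1\<bar> \<le> 2"
      using \<open>1 / 2 \<le> _\<close> unfolding L1 by simp
  next
    have "\<bar>L T (f i)\<bar> \<le> 2 * (1 / (4 * (real i)\<^sup>2 - 1))" if i: "i \<in> {1..n}" for i
    proof -
      have ne: "f j \<noteq> f i" if "j \<noteq> i" for j
        using inj[of UNIV] that by (auto simp: inj_def)
      have "T - {f i} = insert 1 (f ` ({1..n} - {i}))"
        using i one_notin ne by (auto simp: T_def)
      then have "L T (f i) = (0 - 1) / (f i - 1) * (\<Prod>j\<in>{1..n} - {i}. (0 - f j) / (f i - f j))"
        using one_notin unfolding L_def by (subst \<open>T - {f i} = _\<close>, subst prod.insert) (auto simp: prod.reindex inj)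
      \<comment> \<open>The common factor \<open>4\<close> cancels, leaving the ratio for the nodes
        \<open>j^2\<close>.\<close>
      moreover have "\<bar>(0 - f j) / (f i - f j)\<bar> = (real j)\<^sup>2 / \<bar>(real i)\<^sup>2 - (real j)\<^sup>2\<bar>" for j
      proof -
        have "(0 - f j) / (f i - f j) = (4 * - (real j)\<^sup>2) / (4 * ((real i)\<^sup>2 - (real j)\<^sup>2))"
          by (simp add: f_def)
        also have "\<dots> = - (real j)\<^sup>2 / ((real i)\<^sup>2 - (real j)\<^sup>2)"
          by (rule mult_divide_mult_cancel_left) simp
        finally show ?thesis by (simp only: abs_divide abs_minus_cancel abs_power2)
      qed
      ultimately have "\<bar>L T (f i)\<bar> = 1 / (f i - 1) *
          (\<Prod>j\<in>{1..n} - {i}. (real j)\<^sup>2 / \<bar>(real i)\<^sup>2 - (real j)\<^sup>2\<bar>)"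
        using f_ge[of i] i by (simp only: abs_mult abs_prod) simp
      also have "\<dots> \<le> 1 / (f i - 1) * 2"
        using i f_ge[of i] by (intro mult_left_mono prod_squares_ratio_le) auto
      finally show ?thesis by (simp add: f_def)
    qed
    then have "(\<Sum>i=1..n. \<bar>L T (f i)\<bar>) \<le> 2 * (\<Sum>i=1..n. 1 / (4 * (real i)\<^sup>2 - 1))"
      unfolding sum_distrib_left by (intro sum_mono) auto
    also have "\<dots> \<le> 1" unfolding sum_inverse_four_squares by simp
    finally show "(\<Sum>i=1..n. \<bar>L T (f i)\<bar>) \<le> 1" .
  qed
  finally show ?thesis by simp
qed

section \<open>Averages of a single monomial over a Hamming level\<close>

lemma sum_binomial_inter_subsets:
  assumes fin: "finite U" and S: "S \<subseteq> U" and i: "i \<le> t"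
  shows "(\<Sum>Y | Y \<subseteq> U \<and> card Y = t. card (S \<inter> Y) choose i) =
         (card S choose i) * ((card U - i) choose (t - i))"
proof -
  let ?Ys = "{Y. Y \<subseteq> U \<and> card Y = t}" and ?Ts = "{T. T \<subseteq> S \<and> card T = i}"
  have finY: "finite ?Ys" using fin by simp
  have finS: "finite S" using fin S finite_subset by blast
  then have finT: "finite ?Ts" by simp
  \<comment> \<open>Double counting of the pairs of \<open>Y\<close> and an \<open>i\<close>-element
    set \<open>T\<close> contained in both \<open>S\<close> and \<open>Y\<close>. For fixed
    \<open>T\<close>, the set \<open>Y\<close> is completed by \<open>t - i\<close> elements outside
    \<open>T\<close>.\<close>
  have inner: "card (S \<inter> Y) choose i = (\<Sum>T\<in>?Ts. if T \<subseteq> Y then 1 else 0)" for Y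
  proof -
    have "card (S \<inter> Y) choose i = card {T. T \<subseteq> S \<inter> Y \<and> card T = i}"
      using finS by (intro n_subsets[symmetric]) auto
    also have "{T. T \<subseteq> S \<inter> Y \<and> card T = i} = {T \<in> ?Ts. T \<subseteq> Y}" by auto
    finally show ?thesis using finT by (simp add: sum.inter_filter[symmetric])
  qed
  have outer: "(\<Sum>Y\<in>?Ys. if T \<subseteq> Y then 1 else 0) = ((card U - i) choose (t - i))" if T: "T \<in> ?Ts" for T
  proof -
    have finT': "finite T" using T finS finite_subset by blast
    have TU: "T \<subseteq> U" using T S by auto
    have "(\<Sum>Y\<in>?Ys. if T \<subseteq> Y then 1 else 0) = card {Y \<in> ?Ys. T \<subseteq> Y}"
      using finY by (simp add: sum.inter_filter[symmetric])
    also have "\<dots> = card {Z. Z \<subseteq> U - T \<and> card Z = t - i}"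
    proof (rule bij_betw_same_card[of "\<lambda>Y. Y - T"], rule bij_betw_byWitness[where f' = "\<lambda>Z. Z \<union> T"])
      show "(\<lambda>Y. Y - T) ` {Y \<in> ?Ys. T \<subseteq> Y} \<subseteq> {Z. Z \<subseteq> U - T \<and> card Z = t - i}"
        using T finT' by (auto simp: card_Diff_subset)
      have "card (Z \<union> T) = t" if "Z \<subseteq> U - T" "card Z = t - i" for Z
        using that T i finT' fin by (subst card_Un_disjoint) (auto intro: finite_subset)
      then show "(\<lambda>Z. Z \<union> T) ` {Z. Z \<subseteq> U - T \<and> card Z = t - i} \<subseteq> {Y \<in> ?Ys. T \<subseteq> Y}"
        using TU by auto
    qed auto
    also have "\<dots> = ((card U - i) choose (t - i))"
      using fin TU finT' T by (simp add: n_subsets card_Diff_subset)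
    finally show ?thesis .
  qed
  have "(\<Sum>Y\<in>?Ys. card (S \<inter> Y) choose i) = (\<Sum>T\<in>?Ts. \<Sum>Y\<in>?Ys. if T \<subseteq> Y then 1 else 0)"
    unfolding inner by (rule sum.swap)
  also have "\<dots> = (\<Sum>T\<in>?Ts. (card U - i) choose (t - i))"
    using outer by (intro sum.cong) auto
  finally show ?thesis using finS by (simp add: n_subsets)
qed

text \<open>Expand \<open>(-1) ^ m = (1 - 2) ^ m\<close> binomially for
  \<open>m = card (S \<inter> Y)\<close> and sum each term over \<open>Y\<close> by double counting.
  The identity \<open>choose_mult\<close> then isolates \<open>t\<close> in the factor
  \<open>t choose i\<close>, which gives a Newton series in \<open>t\<close>.\<close>

lemma sum_parity_subsets:
  assumes fin: "finite U" and S: "S \<subseteq> U" and t: "t \<le> card U"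
  shows "(\<Sum>Y | Y \<subseteq> U \<and> card Y = t. (-1) ^ card (S \<inter> Y)) / real (card U choose t) =
         (\<Sum>i\<le>t. (-2) ^ i * real (card S choose i) / real (card U choose i) * real (t choose i))"
proof -
  let ?Ys = "{Y. Y \<subseteq> U \<and> card Y = t}"
  have "(-1) ^ card (S \<inter> Y) = (\<Sum>i\<le>t. (-2) ^ i * real (card (S \<inter> Y) choose i))" if "Y \<in> ?Ys" for Y
  proof -
    have le: "card (S \<inter> Y) \<le> t"
      using that fin by (auto intro!: card_mono intro: finite_subset)
    have "(-1::real) ^ card (S \<inter> Y) = (-2 + 1) ^ card (S \<inter> Y)" by simp
    also have "\<dots> = (\<Sum>i\<le>card (S \<inter> Y). (-2) ^ i * real (card (S \<inter> Y) choose i))"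
      unfolding binomial_ring by (simp add: mult.commute)
    \<comment> \<open>The added binomials vanish; the range must not depend on \<open>Y\<close> for
      the sums to be swapped.\<close>
    also have "\<dots> = (\<Sum>i\<le>t. (-2) ^ i * real (card (S \<inter> Y) choose i))"
      using le by (intro sum.mono_neutral_left) auto
    finally show ?thesis .
  qed
  then have "(\<Sum>Y\<in>?Ys. (-1) ^ card (S \<inter> Y)) =
      (\<Sum>Y\<in>?Ys. \<Sum>i\<le>t. (-2) ^ i * real (card (S \<inter> Y) choose i))"
    by (intro sum.cong) auto
  also have "\<dots> = (\<Sum>i\<le>t. (-2) ^ i * real (\<Sum>Y\<in>?Ys. card (S \<inter> Y) choose i))"
    by (subst sum.swap) (simp add: sum_distrib_left)
  also have "\<dots> = (\<Sum>i\<le>t. (-2) ^ i * (real (card S choose i) * real ((card U - i) choose (t - i))))"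
    using sum_binomial_inter_subsets[OF fin S] by (intro sum.cong) auto
  also have "\<dots> = (\<Sum>i\<le>t. (-2) ^ i * real (card S choose i) / real (card U choose i) * real (t choose i))
                    * real (card U choose t)"
    unfolding sum_distrib_right
  proof (intro sum.cong refl)
    fix i assume "i \<in> {..t}"
    then have "real (card U choose t) * real (t choose i) =
        real (card U choose i) * real ((card U - i) choose (t - i))" "card U choose i \<noteq> 0"
      using choose_mult[of i t "card U"] t by (auto simp flip: of_nat_mult)
    then show "(-2) ^ i * (real (card S choose i) * real ((card U - i) choose (t - i))) =
       (-2) ^ i * real (card S choose i) / real (card U choose i) * real (t choose i) * real (card U choose t)"
      by (simp add: field_simps)
  qed
  finally show ?thesis using t by simp
qed

text \<open>The quotient is a product of factors \<open>(j - l) / (d - l)\<close> with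
  \<open>l < i\<close>; while \<open>l < j\<close>, each is at most \<open>j / d\<close> because
  \<open>j \<le> d\<close>, and for \<open>i > j\<close> the numerator is \<open>0\<close>.\<close>

lemma binomial_ratio_le:
  assumes "j \<le> d" "i \<le> d"
  shows "real (j choose i) / real (d choose i) \<le> (real j / real d) ^ i"
  using assms(2)
proof (induction i)
  case (Suc i)
  show ?case
  proof (cases "i < j")
    case True
    have rec: "real (m choose Suc i) = (real m - real i) / real (Suc i) * real (m choose i)" if "i < m" for m
    proof -
      have "Suc i * (m choose Suc i) = (m - i) * (m choose i)"
        using binomial_absorption binomial_absorb_comp by simp
      then have "real (Suc i) * real (m choose Suc i) = real (m - i) * real (m choose i)"
        by (metis of_nat_mult)
      then show ?thesis using that by (simp add: of_nat_diff field_simps)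
    qed
    have "real (j choose Suc i) / real (d choose Suc i) =
        (real j - real i) / (real d - real i) * (real (j choose i) / real (d choose i))"
      using True Suc.prems rec[of j] rec[of d] by simp
    also have "\<dots> \<le> real j / real d * (real j / real d) ^ i"
    proof (intro mult_mono)
      have "real i * real j \<le> real i * real d" using assms(1) by (intro mult_left_mono) auto
      then show "(real j - real i) / (real d - real i) \<le> real j / real d"
        using True assms(1) by (simp add: divide_simps) (simp add: algebra_simps)
    qed (use True Suc in auto)
    finally show ?thesis by simp
  qed (simp add: binomial_eq_0)
qed simp

section \<open>The symmetrized polynomial and its Newton coefficients\<close>

definition flip_point :: "nat \<Rightarrow> nat set \<Rightarrow> nat \<Rightarrow> real" where
  "flip_point d Y = (\<lambda>i\<in>{1..d}. if i \<in> Y then -1 else 1)"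

text \<open>The coefficients, in the Newton basis \<open>t \<mapsto> t choose i\<close>, of the average of the polynomial over
  the points of Hamming weight \<open>t\<close>.\<close>
definition newton_coeff :: "nat \<Rightarrow> (nat set \<Rightarrow> real) \<Rightarrow> nat \<Rightarrow> real" where
  "newton_coeff d c i = (\<Sum>S\<in>Pow {1..d}. c S * ((-2) ^ i * real (card S choose i) / real (d choose i)))"

lemma flip_point_in_cube: "flip_point d Y \<in> cube d"
  by (auto simp: flip_point_def cube_def)

lemma hamming_weight_flip_point: "Y \<subseteq> {1..d} \<Longrightarrow> hamming_weight d (flip_point d Y) = card Y"
  unfolding hamming_weight_def by (rule arg_cong[of _ _ card]) (auto simp: flip_point_def)

lemma OR_fun_flip_point: "Y \<subseteq> {1..d} \<Longrightarrow> OR_fun d (flip_point d Y) = (if Y = {} then 1 else -1)"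
  by (auto simp: OR_fun_def flip_point_def)

lemma mpoly_eval_flip_point:
  "mpoly_eval d c (flip_point d Y) = (\<Sum>S\<in>Pow {1..d}. c S * (-1) ^ card (S \<inter> Y))"
  unfolding mpoly_eval_def
proof (intro sum.cong refl arg_cong2[of _ _ _ _ "(*)"])
  fix S assume "S \<in> Pow {1..d}"
  then have "finite S" and "S \<subseteq> {1..d}" by (auto intro: finite_subset)
  then have "(\<Prod>i\<in>S. flip_point d Y i) = (\<Prod>i\<in>S. if i \<in> Y then -1 else 1)"
    by (intro prod.cong) (auto simp: flip_point_def)
  also have "\<dots> = (-1) ^ card (S \<inter> Y)"
    using \<open>finite S\<close> by (simp add: prod.If_cases)
  finally show "(\<Prod>i\<in>S. flip_point d Y i) = (-1) ^ card (S \<inter> Y)" .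
qed

text \<open>Minsky-Papert symmetrization. Averaging is linear in \<open>c\<close>, so the
  single-monomial formula applies to each \<open>S\<close>.\<close>

lemma average_mpoly_eval:
  assumes "t \<le> d"
  shows "(\<Sum>Y | Y \<subseteq> {1..d} \<and> card Y = t. mpoly_eval d c (flip_point d Y)) / real (d choose t) =
         (\<Sum>i\<le>t. newton_coeff d c i * real (t choose i))"
proof -
  let ?Ys = "{Y. Y \<subseteq> {1..d} \<and> card Y = t}"
  have "(\<Sum>Y\<in>?Ys. mpoly_eval d c (flip_point d Y)) / real (d choose t) =
      (\<Sum>S\<in>Pow {1..d}. c S * ((\<Sum>Y\<in>?Ys. (-1) ^ card (S \<inter> Y)) / real (d choose t)))"
    unfolding mpoly_eval_flip_point
    by (subst sum.swap) (simp add: sum_distrib_left sum_divide_distrib)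
  also have "\<dots> = (\<Sum>S\<in>Pow {1..d}. c S *
      (\<Sum>i\<le>t. (-2) ^ i * real (card S choose i) / real (d choose i) * real (t choose i)))"
    using sum_parity_subsets[of "{1..d}" _ t] assms by (intro sum.cong) auto
  also have "\<dots> = (\<Sum>i\<le>t. newton_coeff d c i * real (t choose i))"
    unfolding newton_coeff_def sum_distrib_left sum_distrib_right
    by (subst sum.swap) (simp add: mult.assoc)
  finally show ?thesis .
qed

lemma card_le_mpoly_degree:
  assumes "S \<subseteq> {1..d}" "c S \<noteq> 0"
  shows "card S \<le> mpoly_degree d c"
  unfolding mpoly_degree_def
proof (rule Max_ge)
  have "{card S |S. S \<subseteq> {1..d} \<and> c S \<noteq> 0} \<subseteq> card ` Pow {1..d}" by auto
  then show "finite {card S |S. S \<subseteq> {1..d} \<and> c S \<noteq> 0}" by (rule finite_subset) simp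
qed (use assms in auto)

text \<open>The geometric decay in \<open>i\<close> is what allows the Newton series to be cut off
  when the degree is small compared with \<open>d\<close>.\<close>

lemma abs_newton_coeff_le:
  assumes i: "i \<le> d"
  shows "\<bar>newton_coeff d c i\<bar> \<le> L1_weight d c * (2 * real (mpoly_degree d c) / real d) ^ i"
proof -
  have "\<bar>c S * ((-2) ^ i * real (card S choose i) / real (d choose i))\<bar> \<le>
      \<bar>c S\<bar> * (2 * real (mpoly_degree d c) / real d) ^ i" if S: "S \<in> Pow {1..d}" for S
  \<comment> \<open>Only sets with \<open>c S \<noteq> 0\<close> are compared with the degree, so
    the unspecified degree of the zero polynomial does no harm.\<close>
  proof (cases "c S = 0")
    case False
    have "card S \<le> d" using S card_mono[of "{1..d}" S] by simp
    then have "real (card S choose i) / real (d choose i) \<le> (real (card S) / real d) ^ i"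
      using i by (rule binomial_ratio_le)
    also have "\<dots> \<le> (real (mpoly_degree d c) / real d) ^ i"
      using card_le_mpoly_degree[of S d c] S False by (intro power_mono divide_right_mono) auto
    finally have "\<bar>c S\<bar> * (2 ^ i * (real (card S choose i) / real (d choose i))) \<le>
        \<bar>c S\<bar> * (2 ^ i * (real (mpoly_degree d c) / real d) ^ i)"
      by (intro mult_left_mono) auto
    then show ?thesis by (simp add: abs_mult power_abs power_mult_distrib power_divide)
  qed simp
  then show ?thesis
    unfolding newton_coeff_def L1_weight_def sum_distrib_right
    by (intro order.trans[OF sum_abs] sum_mono) auto
qed

section \<open>Truncated Newton series and the weight-degree trade-off for fixed
  \<open>d\<close>\<close>

definition newton_poly :: "(nat \<Rightarrow> real) \<Rightarrow> nat \<Rightarrow> real poly" where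
  "newton_poly b n = (\<Sum>i\<le>n. smult (b i / fact i) (\<Prod>l<i. [:- real l, 1:]))"

lemma poly_newton_poly: "poly (newton_poly b n) (real t) = (\<Sum>i\<le>n. b i * real (t choose i))"
  by (simp add: newton_poly_def poly_sum poly_prod binomial_gbinomial gbinomial_prod_rev
      atLeast0LessThan)

lemma degree_newton_poly: "degree (newton_poly b n) \<le> n"
  unfolding newton_poly_def
proof (rule degree_sum_le)
  fix i assume "i \<in> {..n}"
  have "degree (\<Prod>l<i. [:- real l, 1:]) \<le> (\<Sum>l<i. degree [:- real l, 1:])"
    using degree_prod_sum_le[of "{..<i}" "\<lambda>l. [:- real l, 1:]"] by (simp add: o_def)
  then show "degree (smult (b i / fact i) (\<Prod>l<i. [:- real l, 1:])) \<le> n"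
    using \<open>i \<in> {..n}\<close> by (intro order.trans[OF degree_smult_le]) auto
qed simp

text \<open>Only the terms with \<open>n < i \<le> t\<close> are lost. Since
  \<open>x \<le> 1\<close>, their coefficients are at most \<open>W * x ^ Suc n\<close>, and the
  binomials in row \<open>t\<close> add up to \<open>2 ^ t\<close>.\<close>

lemma newton_poly_truncation_error:
  assumes b: "\<And>i. i \<le> t \<Longrightarrow> \<bar>b i\<bar> \<le> W * x ^ i" and W: "0 \<le> W" and x: "0 \<le> x" "x \<le> 1"
  shows "\<bar>(\<Sum>i\<le>t. b i * real (t choose i)) - poly (newton_poly b n) (real t)\<bar> \<le> W * x ^ Suc n * 2 ^ t"
proof (cases "t \<le> n")
  case True
  then have "(\<Sum>i\<le>n. b i * real (t choose i)) = (\<Sum>i\<le>t. b i * real (t choose i))"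
    by (intro sum.mono_neutral_right) auto
  then show ?thesis using W x by (simp add: poly_newton_poly)
next
  case False
  then have "{..t} = {..n} \<union> {n<..t}" by auto
  then have "(\<Sum>i\<le>t. b i * real (t choose i)) - poly (newton_poly b n) (real t) =
      (\<Sum>i\<in>{n<..t}. b i * real (t choose i))"
    unfolding poly_newton_poly by (simp only:) (subst sum.union_disjoint, auto)
  also have "\<bar>\<dots>\<bar> \<le> (\<Sum>i\<in>{n<..t}. \<bar>b i\<bar> * real (t choose i))"
    by (rule order.trans[OF sum_abs]) (simp add: abs_mult)
  also have "\<dots> \<le> (\<Sum>i\<in>{n<..t}. W * x ^ Suc n * real (t choose i))"
  proof (intro sum_mono mult_right_mono)
    fix i assume i: "i \<in> {n<..t}"
    have "\<bar>b i\<bar> \<le> W * x ^ i" using b i by simp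
    also have "\<dots> \<le> W * x ^ Suc n" using i W x by (intro mult_left_mono power_decreasing) auto
    finally show "\<bar>b i\<bar> \<le> W * x ^ Suc n" .
  qed simp
  also have "\<dots> \<le> (\<Sum>i\<le>t. W * x ^ Suc n * real (t choose i))"
    using W x by (intro sum_mono2) auto
  also have "\<dots> = W * x ^ Suc n * real (\<Sum>i\<le>t. t choose i)"
    by (simp add: sum_distrib_left)
  finally show ?thesis by (simp add: choose_row_sum)
qed

text \<open>The right-hand side bounds the truncation error at all weights up to \<open>k\<close>.
  Were it at most \<open>1 / 6\<close>, a polynomial of degree at most \<open>n\<close> would be
  within \<open>1 / 6 + 1 / 6\<close> of OR at \<open>0, ..., k\<close>.\<close>

lemma OR_approx_weight_degree:
  assumes approx: "\<And>x. x \<in> cube d \<Longrightarrow> hamming_weight d x \<le> k \<Longrightarrow> \<bar>mpoly_eval d c x - OR_fun d x\<bar> \<le> 1 / 6"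
    and k: "1 \<le> k" "k \<le> d" and n: "4 * n\<^sup>2 \<le> k" and deg: "2 * mpoly_degree d c \<le> d"
  shows "1 / 6 < L1_weight d c * (2 * real (mpoly_degree d c) / real d) ^ Suc n * 2 ^ k"
proof (rule ccontr)
  define W where "W = L1_weight d c"
  define x where "x = 2 * real (mpoly_degree d c) / real d"
  define q where "q = newton_poly (newton_coeff d c) n"
  assume "\<not> ?thesis"
  then have small: "W * x ^ Suc n * 2 ^ k \<le> 1 / 6" by (simp add: W_def x_def)
  have W: "0 \<le> W" by (simp add: W_def L1_weight_def sum_nonneg)
  have x: "0 \<le> x" "x \<le> 1" using deg k by (auto simp: x_def divide_simps)
  have q: "\<bar>poly q (real t) - (if t = 0 then 1 else -1)\<bar> \<le> 1 / 3" if t: "t \<le> k" for t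
  proof -
    let ?Ys = "{Y. Y \<subseteq> {1..d} \<and> card Y = t}" and ?v = "if t = 0 then 1 else -1 :: real"
    let ?avg = "\<Sum>i\<le>t. newton_coeff d c i * real (t choose i)"
    have pos: "real (d choose t) > 0" using t k by simp
    have card: "card ?Ys = d choose t" using n_subsets[of "{1..d}" t] by simp
    have "\<bar>(\<Sum>Y\<in>?Ys. mpoly_eval d c (flip_point d Y)) - real (d choose t) * ?v\<bar> =
        \<bar>\<Sum>Y\<in>?Ys. mpoly_eval d c (flip_point d Y) - ?v\<bar>"
      by (simp only: sum_subtractf sum_constant card)
    also have "\<dots> \<le> (\<Sum>Y\<in>?Ys. 1 / 6)"
    proof (intro order.trans[OF sum_abs] sum_mono)
      fix Y assume Y: "Y \<in> ?Ys"
      then have "finite Y" by (auto intro: finite_subset)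
      then have "OR_fun d (flip_point d Y) = ?v" using Y by (auto simp: OR_fun_flip_point)
      moreover have "\<bar>mpoly_eval d c (flip_point d Y) - OR_fun d (flip_point d Y)\<bar> \<le> 1 / 6"
        using Y t by (intro approx flip_point_in_cube) (auto simp: hamming_weight_flip_point)
      ultimately show "\<bar>mpoly_eval d c (flip_point d Y) - ?v\<bar> \<le> 1 / 6" by simp
    qed
    also have "\<dots> = real (d choose t) * (1 / 6)" by (simp only: sum_constant card)
    finally have "\<bar>(\<Sum>Y\<in>?Ys. mpoly_eval d c (flip_point d Y)) - real (d choose t) * ?v\<bar>
        \<le> real (d choose t) * (1 / 6)" .
    moreover have "(\<Sum>Y\<in>?Ys. mpoly_eval d c (flip_point d Y)) = real (d choose t) * ?avg"
      using average_mpoly_eval[of t d c] t k pos by (simp add: field_simps)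
    ultimately have "real (d choose t) * \<bar>?avg - ?v\<bar> \<le> real (d choose t) * (1 / 6)"
      using pos by (simp only: right_diff_distrib[symmetric] abs_mult abs_of_pos)
    then have "\<bar>?avg - ?v\<bar> \<le> 1 / 6" using pos by (simp only: mult_le_cancel_left_pos)
    moreover have "\<bar>?avg - poly q (real t)\<bar> \<le> W * x ^ Suc n * 2 ^ t"
      unfolding q_def using abs_newton_coeff_le t k W x
      by (intro newton_poly_truncation_error) (auto simp: W_def x_def)
    moreover have "W * x ^ Suc n * 2 ^ t \<le> W * x ^ Suc n * 2 ^ k"
      using t W x by (intro mult_left_mono power_increasing) auto
    ultimately show ?thesis using small by linarith
  qed
  \<comment> \<open>The shift makes the target value \<open>0\<close> at all positive weights. The
    nodes lie in \<open>1, ..., k\<close> because \<open>4 * n^2 \<le> k\<close>. The resulting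
    bound \<open>1\<close> contradicts \<open>q + 1\<close> being at least \<open>5 / 3\<close> at
    \<open>0\<close>.\<close>
  have "\<bar>poly (q + 1) 0\<bar> \<le> 3 * (1 / 3)"
  proof (rule poly_zero_le_of_square_nodes)
    show "degree (q + 1) \<le> n"
      unfolding q_def using degree_newton_poly by (intro degree_add_le) auto
    show "\<bar>poly (q + 1) 1\<bar> \<le> 1 / 3" using q[of 1] k by simp
    fix i assume i: "i \<in> {1..n}"
    then have "i\<^sup>2 \<le> n\<^sup>2" by (intro power_mono) auto
    then have "4 * i\<^sup>2 \<le> k" using n by linarith
    then show "\<bar>poly (q + 1) (4 * (real i)\<^sup>2)\<bar> \<le> 1 / 3" using q[of "4 * i\<^sup>2"] i by simp
  qed
  then show False using q[of 0] by simp
qed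

section \<open>The asymptotic degree bound\<close>

theorem theorem1p4:
  fixes C :: real
  shows "\<exists>A>0. \<forall>k :: nat \<Rightarrow> nat. (\<lambda>d. real (k d)) \<in> o(\<lambda>d. ln (real d)) \<longrightarrow>
    (\<forall>\<^sub>F d in sequentially. \<forall>p :: nat set \<Rightarrow> real.
       k d \<ge> 1 \<longrightarrow>
       (\<forall>x\<in>cube d. hamming_weight d x \<le> k d \<longrightarrow> \<bar>mpoly_eval d p x - OR_fun d x\<bar> \<le> 1 / 6) \<longrightarrow>
       L1_weight d p \<le> real d powr C \<longrightarrow>
       real (mpoly_degree d p) \<ge> real d powr (1 - A / sqrt (real (k d))))"
proof -
  \<comment> \<open>Chosen so that \<open>C - A / 2 + 1 \<le> -1\<close>: the weight contributes
    \<open>C\<close>, the power of \<open>y\<close> contributes \<open>- A / 2\<close>, and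
    \<open>4 ^ k \<le> d\<close> contributes \<open>1\<close>.\<close>
  define A where "A = 2 * \<bar>C\<bar> + 4"
  \<comment> \<open>The growth condition on \<open>k\<close> enters as
    \<open>k \<le> ln d / 2\<close>, which gives \<open>4 ^ k \<le> exp (2 * k) \<le> d\<close>; and
    \<open>6 \<le> d\<close> makes the final \<open>1 / d\<close> at most
    \<open>1 / 6\<close>.\<close>
  have bound: "real (mpoly_degree d p) \<ge> real d powr (1 - A / sqrt (real k))"
    if d: "6 \<le> d" and k: "1 \<le> k" and kd: "real k \<le> 1 / 2 * ln (real d)"
      and approx: "\<forall>x\<in>cube d. hamming_weight d x \<le> k \<longrightarrow> \<bar>mpoly_eval d p x - OR_fun d x\<bar> \<le> 1 / 6"
      and W: "L1_weight d p \<le> real d powr C" for d k p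
  proof (rule ccontr)
    define D where "D = mpoly_degree d p"
    \<comment> \<open>Rounding down gives \<open>4 * n^2 \<le> k\<close>, so the nodes fit, while
      \<open>Suc n\<close> is still at least \<open>sqrt k / 2\<close>.\<close>
    define n where "n = nat \<lfloor>sqrt (real k) / 2\<rfloor>"
    define y where "y = 2 * real d powr (- A / sqrt (real k))"
    assume "\<not> ?thesis"
    then have D: "real D < real d powr (1 - A / sqrt (real k))" by (simp add: D_def)
    have "real d powr (1 - A / sqrt (real k)) = real d * real d powr (- A / sqrt (real k))"
      using d powr_add[of "real d" 1 "- A / sqrt (real k)"] by simp
    then have Dy: "2 * real D / real d \<le> y" using D d by (simp add: y_def divide_simps mult_ac)
    have lnd: "2 \<le> ln (real d)" using k kd by linarith
    have sqrtk: "1 \<le> sqrt (real k)" "sqrt (real k) \<le> real k"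
      using k by (auto simp: real_sqrt_le_iff intro: real_le_lsqrt simp: power2_eq_square)
    \<comment> \<open>This yields \<open>y \<le> 1\<close>, needed both for
      \<open>2 * D \<le> d\<close> and for powers of \<open>y\<close> to decrease in the
      exponent.\<close>
    have "real d powr (- A / sqrt (real k)) \<le> exp (-1)"
    proof -
      have "sqrt (real k) \<le> A * ln (real d)"
      proof -
        have "1 * ln (real d) \<le> A * ln (real d)" using lnd by (intro mult_right_mono) (auto simp: A_def)
        then show ?thesis using sqrtk kd lnd by linarith
      qed
      then show ?thesis using sqrtk d by (simp add: powr_def divide_simps)
    qed
    also have "\<dots> \<le> 1 / 2" using exp_ge_add_one_self[of 1] by (simp add: exp_minus divide_simps)
    finally have y: "0 < y" "y \<le> 1" using d by (auto simp: y_def)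
    have "2 * real D / real d \<le> 1" using Dy y by linarith
    then have "real (2 * D) \<le> real d" using d by (simp add: divide_simps split: if_splits)
    then have deg: "2 * mpoly_degree d p \<le> d" by (simp only: of_nat_le_iff D_def)
    have "real n = real_of_int \<lfloor>sqrt (real k) / 2\<rfloor>" by (simp add: n_def)
    then have nk: "real n \<le> sqrt (real k) / 2" "sqrt (real k) / 2 \<le> real (Suc n)"
      using floor_correct[of "sqrt (real k) / 2"] by linarith+
    have "(2 * real n)\<^sup>2 \<le> (sqrt (real k))\<^sup>2" using nk by (intro power_mono) auto
    then have "real (4 * n\<^sup>2) \<le> real k" by (simp add: power_mult_distrib)
    then have n: "4 * n\<^sup>2 \<le> k" by (simp only: of_nat_le_iff)
    have "real k \<le> real d" using kd ln_le_minus_one[of "real d"] lnd d by linarith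
    then have k_le: "k \<le> d" by simp
    have "4 ^ k \<le> real d"
    proof -
      have "4 \<le> exp (2::real)" using exp_ge_add_one_self[of 1] mult_mono[of 2 "exp 1" 2 "exp (1::real)"]
        by (simp flip: exp_add)
      then have "4 ^ k \<le> exp (2::real) ^ k" by (intro power_mono) auto
      also have "\<dots> = exp (real k * 2)" by (rule exp_of_nat_mult[symmetric])
      also have "\<dots> \<le> exp (ln (real d))" using kd by simp
      finally show ?thesis using d by simp
    qed
    \<comment> \<open>Raising to \<open>sqrt k / 2\<close> cancels the \<open>sqrt k\<close> in the
      exponent of \<open>d\<close>, leaving \<open>- A / 2\<close> whatever \<open>k\<close> is. The
      leftover power of \<open>2\<close> is weakened to \<open>2 ^ k\<close>, to merge with the
      \<open>2 ^ k\<close> of the truncation error into \<open>4 ^ k\<close>.\<close>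
    have "y ^ Suc n = y powr real (Suc n)" using y by (simp only: powr_realpow)
    also have "\<dots> \<le> y powr (sqrt (real k) / 2)" using y nk by (intro powr_mono') auto
    also have "\<dots> = 2 powr (sqrt (real k) / 2) * real d powr (- A / 2)"
      using sqrtk d by (simp add: y_def powr_mult powr_powr)
    also have "\<dots> \<le> 2 powr real k * real d powr (- A / 2)"
      using sqrtk by (intro mult_right_mono powr_mono) auto
    also have "\<dots> = 2 ^ k * real d powr (- A / 2)" by (simp add: powr_realpow)
    finally have yn: "y ^ Suc n \<le> 2 ^ k * real d powr (- A / 2)" .
    have "1 / 6 < L1_weight d p * (2 * real D / real d) ^ Suc n * 2 ^ k"
      unfolding D_def using approx k k_le n deg by (intro OR_approx_weight_degree) auto
    also have "\<dots> \<le> real d powr C * y ^ Suc n * 2 ^ k"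
      using W Dy by (intro mult_right_mono mult_mono power_mono) auto
    also have "\<dots> \<le> real d powr C * (2 ^ k * real d powr (- A / 2)) * 2 ^ k"
      using yn by (intro mult_right_mono mult_left_mono) auto
    also have "\<dots> = real d powr C * real d powr (- A / 2) * 4 ^ k"
      by (simp add: mult_ac flip: power_mult_distrib)
    also have "\<dots> \<le> real d powr C * real d powr (- A / 2) * real d powr 1"
      using \<open>4 ^ k \<le> real d\<close> d by (intro mult_left_mono) auto
    also have "\<dots> = real d powr (C + - A / 2 + 1)" by (simp only: powr_add)
    also have "\<dots> \<le> real d powr (-1)" using d by (intro powr_mono) (auto simp: A_def field_simps)
    also have "\<dots> \<le> 1 / 6" using d by (simp add: powr_minus divide_simps)
    finally show False by simp
  qed
  show ?thesis
  proof (intro exI[of _ A] conjI allI impI)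
    show "A > 0" by (simp add: A_def)
    fix k :: "nat \<Rightarrow> nat"
    assume "(\<lambda>d. real (k d)) \<in> o(\<lambda>d. ln (real d))"
    then have "\<forall>\<^sub>F d in sequentially. norm (real (k d)) \<le> 1 / 2 * norm (ln (real d))"
      by (rule landau_o.smallD) simp
    with eventually_ge_at_top[of 6]
    show "\<forall>\<^sub>F d in sequentially. \<forall>p :: nat set \<Rightarrow> real.
       k d \<ge> 1 \<longrightarrow>
       (\<forall>x\<in>cube d. hamming_weight d x \<le> k d \<longrightarrow> \<bar>mpoly_eval d p x - OR_fun d x\<bar> \<le> 1 / 6) \<longrightarrow>
       L1_weight d p \<le> real d powr C \<longrightarrow>
       real (mpoly_degree d p) \<ge> real d powr (1 - A / sqrt (real (k d)))"
    proof eventually_elim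
      case (elim d)
      then have "real (k d) \<le> 1 / 2 * ln (real d)" by simp
      then show ?case using bound elim(1) by blast
    qed
  qed
qed

end
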